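(* Let $\mathcal{A}$ be an $m$-order $n$-dimensional real tensor whose off-diagonal entries are all nonpositive. Then $\mathcal{A}$ is an $M$-tensor if and only if all of the real eigenvalues of $\mathcal{A}$ are positive.
   Context: Let $m\ge 2$ and $n\ge 1$ be integers. An $m$-order $n$-dimensional (square real) tensor is an array $\mathcal{A}=(A_{i_1\cdots i_m})$ with $A_{i_1\cdots i_m}\in\mathbb{R}$, $1\le i_1,\dots,i_m\le n$. Its diagonal entries are $A_{i\ldots i}$, $1\le i\le n$; all other entries are off-diagonal. It is nonnegative if all its entries are $\ge 0$. The unit tensor $\mathcal{I}$ has entries $\delta_{i_1\ldots i_m}=1$ if $i_1=\cdots=i_m$ and $0$ otherwise. For $x\in\mathbb{C}^n$, $\mathcal{A}x^{m-1}\in\mathbb{C}^n$ has $i$-th component $\sum_{i_2,\ldots,i_m=1}^n A_{ii_2\cdots i_m}x_{i_2}\cdots x_{i_m}$, and $x^{[m-1]}=(x_i^{m-1})_{1\le i\le n}$. A number $\lambda\in\mathbb{C}$ is an eigenvalue of $\mathcal{A}$ with eigenvector $x\in\mathbb{C}^n\setminus\{0\}$ if $\mathcal{A}x^{m-1}=\lambda x^{[m-1]}$. A real eigenvalue is an eigenvalue $\lambda\in\mathbb{R}$ (its eigenvectors are allowed to be complex). The spectral radius is $\rho(\mathcal{A})=\max\{|\lambda| : \lambda \text{ is an eigenvalue of } \mathcal{A}\}$. $\mathcal{A}$ is an $M$-tensor if there exist a nonnegative tensor $\mathcal{B}$ (of the same order and dimension) and a real number $c>\rho(\mathcal{B})$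 such that $\mathcal{A}=c\mathcal{I}-\mathcal{B}$. *)

theory Defs
  imports "HOL-Analysis.Analysis"
begin

text \<open>
  An \<open>m\<close>-order tensor of dimension \<open>CARD('n)\<close> is given by its entries, indexed by lists
  \<open>[i\<^sub>1, \<dots>, i\<^sub>m]\<close> over \<open>'n\<close>. Only the values on lists of length \<open>m\<close> are
  meaningful; hence the order \<open>m\<close> is an argument of all notions below, and none of them depends
  on the values at other lists.
\<close>

type_synonym 'n tensor = "'n list \<Rightarrow> real"

definition diagonal_index :: "nat \<Rightarrow> 'n list \<Rightarrow> bool" where
  "diagonal_index m js \<longleftrightarrow> (\<exists>i. js = replicate m i)"

definition nonneg_tensor :: "nat \<Rightarrow> 'n tensor \<Rightarrow> bool" where
  "nonneg_tensor m A \<longleftrightarrow> (\<forall>js. length js = m \<longrightarrow> A js \<ge> 0)"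

definition unit_tensor :: "nat \<Rightarrow> 'n tensor" where
  "unit_tensor m js = (if diagonal_index m js then 1 else 0)"

definition tensor_apply :: "nat \<Rightarrow> 'n::finite tensor \<Rightarrow> complex ^ 'n \<Rightarrow> complex ^ 'n" where
  "tensor_apply m A x =
     (\<chi> i. \<Sum>js | length js = m - 1. of_real (A (i # js)) * (\<Prod>j\<leftarrow>js. x $ j))"

definition tensor_eigenvector ::
    "nat \<Rightarrow> 'n::finite tensor \<Rightarrow> complex ^ 'n \<Rightarrow> complex \<Rightarrow> bool" where
  "tensor_eigenvector m A x l \<longleftrightarrow>
     x \<noteq> 0 \<and> tensor_apply m A x = (\<chi> i. l * (x $ i) ^ (m - 1))"

definition tensor_eigenvalue :: "nat \<Rightarrow> 'n::finite tensor \<Rightarrow> complex \<Rightarrow> bool" where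
  "tensor_eigenvalue m A l \<longleftrightarrow> (\<exists>x. tensor_eigenvector m A x l)"

text \<open>
  The maximum is taken with \<open>Greatest\<close> rather than \<open>Max\<close>, since the latter is only
  specified for sets already known to be finite.
\<close>

definition tensor_spectral_radius :: "nat \<Rightarrow> 'n::finite tensor \<Rightarrow> real" where
  "tensor_spectral_radius m A = (GREATEST r. r \<in> {cmod l |l. tensor_eigenvalue m A l})"

definition M_tensor :: "nat \<Rightarrow> 'n::finite tensor \<Rightarrow> bool" where
  "M_tensor m A \<longleftrightarrow>
     (\<exists>(B :: 'n tensor) (c :: real). nonneg_tensor m B \<and> c > tensor_spectral_radius m B \<and>
        (\<forall>js. length js = m \<longrightarrow> A js = c * unit_tensor m js - B js))"

end

theory Submission imports Defs begin

text \<open>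
  The heart of the matter is the weak Perron--Frobenius theorem: a nonnegative tensor \<open>B\<close> has a
  real eigenvalue that bounds the modulus of all its eigenvalues. For positive \<open>B\<close>, Brouwer's
  theorem for the map on the standard simplex that takes componentwise \<open>(m-1)\<close>-th roots of
  \<open>B x\<close> and normalises yields a positive eigenvector \<open>x\<close>. Comparing \<open>x\<close> with \<open>|y|\<close>, for an
  arbitrary eigenvector \<open>y\<close>, at an index maximising \<open>|y\<^sub>i| / x\<^sub>i\<close> shows that its eigenvalue
  dominates. The nonnegative case follows by adding \<open>\<epsilon>\<close> to all entries and letting \<open>\<epsilon>\<close> tend
  to 0. Finally, the eigenvalues of \<open>c I - B\<close> are the numbers \<open>c - l\<close> with \<open>l\<close> an eigenvalue
  of \<open>B\<close>; for the converse direction \<open>c\<close> is the largest diagonal entry.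
\<close>

text \<open>Real counterpart of \<open>tensor_apply\<close>: Brouwer's theorem and the order
  arguments below work with real vectors.\<close>

definition real_apply :: "nat \<Rightarrow> 'n::finite tensor \<Rightarrow> real ^ 'n \<Rightarrow> real ^ 'n" where
  "real_apply m A x = (\<chi> i. \<Sum>js | length js = m - 1. A (i # js) * (\<Prod>j\<leftarrow>js. x $ j))"

definition simplex_vec :: "(real ^ 'n::finite) set" where
  "simplex_vec = {x. (\<forall>i. 0 \<le> x $ i) \<and> (\<Sum>i\<in>UNIV. x $ i) = 1}"

section \<open>Sums and products over index lists, and the map \<open>real_apply\<close>\<close>

lemma finite_lists_of_length: "finite {js :: 'n::finite list. length js = k}"
  using finite_lists_length_eq[of "UNIV :: 'n set" k] by simp

lemma prod_list_map_nonneg: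
  "(\<And>j. j \<in> set js \<Longrightarrow> 0 \<le> f j) \<Longrightarrow> 0 \<le> (\<Prod>j\<leftarrow>js. f j :: real)"
  by (induction js) auto

lemma prod_list_map_mono:
  "(\<And>j. j \<in> set js \<Longrightarrow> 0 \<le> f j \<and> f j \<le> g j) \<Longrightarrow> (\<Prod>j\<leftarrow>js. f j :: real) \<le> (\<Prod>j\<leftarrow>js. g j)"
proof (induction js)
  case (Cons j js)
  have "0 \<le> f j" "f j \<le> g j" "0 \<le> g j" using Cons.prems[of j] by auto
  moreover have "0 \<le> (\<Prod>j\<leftarrow>js. f j)" using Cons.prems by (intro prod_list_map_nonneg) auto
  ultimately show ?case using Cons by (simp add: mult_mono)
qed simp

lemma prod_list_map_scale:
  "(\<Prod>j\<leftarrow>js. t * f j) = t ^ length js * (\<Prod>j\<leftarrow>js. f j :: real)"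
  by (induction js) auto

lemma norm_prod_list_map:
  "norm (\<Prod>j\<leftarrow>js. f j :: 'a::real_normed_field) = (\<Prod>j\<leftarrow>js. norm (f j))"
  by (induction js) (auto simp: norm_mult)

lemma of_real_prod_list_map:
  "(\<Prod>j\<leftarrow>js. of_real (f j)) = (of_real (\<Prod>j\<leftarrow>js. f j) :: 'a::real_normed_field)"
  by (induction js) auto

lemma tendsto_prod_list_map:
  fixes f :: "'a \<Rightarrow> 'b \<Rightarrow> real"
  shows "(\<And>j. ((\<lambda>x. f x j) \<longlongrightarrow> g j) F) \<Longrightarrow> ((\<lambda>x. \<Prod>j\<leftarrow>js. f x j) \<longlongrightarrow> (\<Prod>j\<leftarrow>js. g j)) F"
  by (induction js) (auto intro!: tendsto_mult)

text \<open>Tensor and vector vary together. A constant tensor gives the continuity that Brouwer's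
  theorem asks for; the general form serves the limit from positive to nonnegative tensors.\<close>

lemma tendsto_real_apply_nth:
  assumes "\<And>js. length js = m \<Longrightarrow> ((\<lambda>n. B n js) \<longlongrightarrow> C js) F" "(x \<longlongrightarrow> y) F" "m \<ge> 1"
  shows "((\<lambda>n. real_apply m (B n) (x n) $ i) \<longlongrightarrow> real_apply m C y $ i) F"
  using assms unfolding real_apply_def
  by (auto intro!: tendsto_sum tendsto_mult tendsto_prod_list_map tendsto_vec_nth)

lemma real_apply_nth_nonneg:
  assumes "nonneg_tensor m B" "m \<ge> 1" "\<And>j. 0 \<le> x $ j"
  shows "0 \<le> real_apply m B x $ i"
  using assms unfolding real_apply_def nonneg_tensor_def
  by (auto intro!: sum_nonneg mult_nonneg_nonneg prod_list_map_nonneg)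

lemma real_apply_nth_pos:
  assumes pos: "\<And>js. length js = m \<Longrightarrow> B js > 0" and m: "m \<ge> 1"
    and x: "\<And>j. 0 \<le> x $ j" "0 < x $ k"
  shows "0 < real_apply m B x $ i"
proof -
  \<comment> \<open>The term of this list is \<open>B (i # ?js) * (x $ k) ^ (m - 1)\<close>, which
    is positive, while every other term is nonnegative.\<close>
  let ?js = "replicate (m - 1) k"
  have "0 < (\<Sum>js | length js = m - 1. B (i # js) * (\<Prod>j\<leftarrow>js. x $ j))"
  proof (rule sum_pos2[OF finite_lists_of_length, of ?js])
    show "0 < B (i # ?js) * (\<Prod>j\<leftarrow>?js. x $ j)"
      using pos[of "i # ?js"] m x(2) by simp
  next
    fix js :: "'a list" assume "js \<in> {js. length js = m - 1}"
    then show "0 \<le> B (i # js) * (\<Prod>j\<leftarrow>js. x $ j)"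
      using pos[of "i # js"] m x(1) by (auto intro!: mult_nonneg_nonneg prod_list_map_nonneg)
  qed simp
  then show ?thesis by (simp add: real_apply_def)
qed

section \<open>The standard simplex\<close>

lemma simplex_vecD:
  assumes "x \<in> simplex_vec"
  shows "0 \<le> x $ i" "x $ i \<le> 1" "\<exists>k. 0 < x $ k"
proof -
  show nn: "0 \<le> x $ i" for i using assms by (simp add: simplex_vec_def)
  have s: "(\<Sum>i\<in>UNIV. x $ i) = 1" using assms by (simp add: simplex_vec_def)
  show "x $ i \<le> 1" using member_le_sum[of i UNIV "\<lambda>i. x $ i"] nn s by simp
  show "\<exists>k. 0 < x $ k"
  proof (rule ccontr)
    assume "\<not> ?thesis"
    then have "(\<Sum>i\<in>UNIV. x $ i) \<le> 0" by (intro sum_nonpos) (auto simp: not_less)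
    with s show False by simp
  qed
qed

lemma compact_simplex_vec: "compact (simplex_vec :: (real ^ 'n::finite) set)"
proof -
  have "simplex_vec \<subseteq> cbox (0 :: real ^ 'n) 1"
    using simplex_vecD by (auto simp: mem_box_cart)
  moreover have "closed (simplex_vec :: (real ^ 'n) set)"
    unfolding simplex_vec_def
    by (intro closed_Collect_conj closed_Collect_all closed_Collect_le closed_Collect_eq
        continuous_intros)
  ultimately show ?thesis
    using bounded_cbox bounded_subset compact_eq_bounded_closed by blast
qed

lemma convex_simplex_vec: "convex (simplex_vec :: (real ^ 'n::finite) set)"
  by (auto simp: convex_def simplex_vec_def sum.distrib simp flip: sum_distrib_left)

lemma simplex_vec_nonempty: "(simplex_vec :: (real ^ 'n::finite) set) \<noteq> {}"
proof -
  have "(axis i 1 :: real ^ 'n) \<in> simplex_vec" for i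
    by (simp add: simplex_vec_def axis_def)
  then show ?thesis by blast
qed

section \<open>The weak Perron-Frobenius theorem\<close>

lemma positive_eigenvector:
  fixes B :: "'n::finite tensor"
  assumes pos: "\<And>js. length js = m \<Longrightarrow> B js > 0" and m: "m \<ge> 2"
  obtains x l where "x \<in> simplex_vec" "\<And>i. 0 < x $ i" "0 \<le> l"
    "\<And>i. real_apply m B x $ i = l * (x $ i) ^ (m - 1)"
proof -
  define g where "g = (\<lambda>x i. root (m - 1) (real_apply m B x $ i))"
  define f where "f = (\<lambda>x :: real ^ 'n. \<chi> i. g x i / (\<Sum>j\<in>UNIV. g x j))"
  have g_pos: "0 < g x i" if x: "x \<in> simplex_vec" for x i
  proof -
    obtain k where "0 < x $ k" using simplex_vecD(3)[OF x] by blast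
    then have "0 < real_apply m B x $ i"
      using m simplex_vecD(1)[OF x] by (intro real_apply_nth_pos[OF pos]) auto
    then show ?thesis using m by (simp add: g_def)
  qed
  have G_pos: "0 < (\<Sum>j\<in>UNIV. g x j)" if "x \<in> simplex_vec" for x
    using g_pos[OF that] by (intro sum_pos) auto
  have "continuous_on simplex_vec f"
  proof -
    have "continuous_on simplex_vec (\<lambda>x. g x i)" for i
      unfolding g_def continuous_on_def using m
      by (auto intro!: tendsto_real_root tendsto_real_apply_nth tendsto_ident_at)
    then show ?thesis
      unfolding f_def using G_pos
      by (intro continuous_on_vec_lambda continuous_intros) (auto simp: less_imp_neq[symmetric])
  qed
  moreover have "f \<in> simplex_vec \<rightarrow> simplex_vec"
  proof
    fix x :: "real ^ 'n" assume x: "x \<in> simplex_vec"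
    show "f x \<in> simplex_vec"
      using g_pos[OF x] G_pos[OF x]
      by (auto simp: f_def simplex_vec_def less_imp_le simp flip: sum_divide_distrib)
  qed
  ultimately obtain x where x: "x \<in> simplex_vec" "f x = x"
    using brouwer[OF compact_simplex_vec convex_simplex_vec simplex_vec_nonempty] by metis
  \<comment> \<open>At the fixed point \<open>g x i = G * x $ i\<close>. Raising this to the power
    \<open>m - 1\<close> undoes the root and leaves the eigenvalue
    \<open>G ^ (m - 1)\<close>.\<close>
  define G where "G = (\<Sum>j\<in>UNIV. g x j)"
  have xi: "x $ i = g x i / G" for i
    using arg_cong[OF x(2), of "\<lambda>v. v $ i"] by (simp add: f_def G_def)
  have G: "0 < G" using G_pos[OF x(1)] by (simp add: G_def)
  show ?thesis
  proof (rule that[OF x(1)])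
    show "0 < x $ i" for i using xi g_pos[OF x(1)] G by simp
    show "0 \<le> G ^ (m - 1)" using G by simp
    show "real_apply m B x $ i = G ^ (m - 1) * (x $ i) ^ (m - 1)" for i
    proof -
      have "g x i ^ (m - 1) = real_apply m B x $ i"
        unfolding g_def using m pos simplex_vecD(1)[OF x(1)]
        by (intro real_root_pow_pos2 real_apply_nth_nonneg)
          (auto simp: nonneg_tensor_def less_imp_le)
      then show ?thesis using xi[of i] G by (simp add: power_divide)
    qed
  qed
qed

text \<open>With \<open>t\<close> the largest ratio \<open>y $ i / x $ i\<close>, \<open>y\<close>
  lies below \<open>t * x\<close> and touches it at some \<open>i\<close>. Monotonicity and
  homogeneity of degree \<open>m - 1\<close> then compare \<open>s\<close> with \<open>l\<close> at
  that \<open>i\<close>. Two tensors \<open>B \<le> C\<close> and inequalities in place of equations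
  allow both comparing perturbed tensors and bounding moduli of complex eigenvectors.\<close>

lemma collatz_wielandt_bound:
  fixes B :: "'n::finite tensor"
  assumes m: "m \<ge> 1" and nonneg: "nonneg_tensor m B"
    and le: "\<And>js. length js = m \<Longrightarrow> B js \<le> C js"
    and x: "\<And>i. 0 < x $ i" "\<And>i. real_apply m C x $ i \<le> l * (x $ i) ^ (m - 1)"
    and y: "\<And>i. 0 \<le> y $ i" "y \<noteq> 0" "\<And>i. s * (y $ i) ^ (m - 1) \<le> real_apply m B y $ i"
  shows "s \<le> l"
proof -
  define t where "t = Max (range (\<lambda>i. y $ i / x $ i))"
  have "t \<in> range (\<lambda>i. y $ i / x $ i)" unfolding t_def by (intro Max_in) auto
  then obtain i where i: "t = y $ i / x $ i" by auto
  have ub: "y $ j \<le> t * x $ j" for j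
  proof -
    have "y $ j / x $ j \<le> t" unfolding t_def by (intro Max_ge) auto
    then show ?thesis using x(1)[of j] by (simp add: divide_le_eq)
  qed
  \<comment> \<open>Positivity of \<open>t\<close>, hence of \<open>y $ i\<close>, permits
    cancelling \<open>(y $ i) ^ (m - 1)\<close> at the end.\<close>
  obtain k where "y $ k \<noteq> 0" using y(2) by (auto simp: vec_eq_iff)
  then have "0 < t * x $ k" using y(1)[of k] ub[of k] by linarith
  then have t: "0 < t" using x(1)[of k] by (simp add: zero_less_mult_iff)
  have yi: "y $ i = t * x $ i" using i x(1)[of i] by simp
  have "s * (y $ i) ^ (m - 1) \<le> real_apply m B y $ i" by (rule y(3))
  also have "\<dots> \<le> (\<Sum>js | length js = m - 1. C (i # js) * (\<Prod>j\<leftarrow>js. t * x $ j))"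
    unfolding real_apply_def
  proof (simp, rule sum_mono, rule mult_mono)
    fix js :: "'n list" assume "js \<in> {js. length js = m - Suc 0}"
    then have len: "length (i # js) = m" using m by simp
    show "B (i # js) \<le> C (i # js)" using le len by blast
    show "0 \<le> C (i # js)" using order_trans[of 0 "B (i # js)"] le[OF len] nonneg len unfolding nonneg_tensor_def by blast
    show "0 \<le> (\<Prod>j\<leftarrow>js. y $ j)" using y(1) by (intro prod_list_map_nonneg)
    show "(\<Prod>j\<leftarrow>js. y $ j) \<le> (\<Prod>j\<leftarrow>js. t * x $ j)"
      using y(1) ub by (intro prod_list_map_mono) auto
  qed
  also have "\<dots> = t ^ (m - 1) * real_apply m C x $ i"
    by (auto simp: real_apply_def prod_list_map_scale sum_distrib_left intro!: sum.cong)
  also have "\<dots> \<le> t ^ (m - 1) * (l * (x $ i) ^ (m - 1))"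
    using t x(2) by (intro mult_left_mono) auto
  also have "\<dots> = l * (y $ i) ^ (m - 1)" by (simp add: yi power_mult_distrib)
  finally show ?thesis using yi t x(1)[of i] by (simp add: mult_le_cancel_right)
qed

text \<open>The limit eigenvector may have zero entries, so \<open>collatz_wielandt_bound\<close>
  cannot be applied to it. Dominance is instead shown for the eigenvalue of each positive
  perturbation of \<open>B\<close> and survives the limit.\<close>

lemma nonneg_dominant_eigenpair:
  fixes B :: "'n::finite tensor"
  assumes nonneg: "nonneg_tensor m B" and m: "m \<ge> 2"
  obtains x r where "x \<in> simplex_vec"
    "\<And>i. real_apply m B x $ i = r * (x $ i) ^ (m - 1)"
    "0 \<le> r"
    "\<And>y s. \<lbrakk>\<And>i. 0 \<le> y $ i; y \<noteq> 0; \<And>i. s * (y $ i) ^ (m - 1) \<le> real_apply m B y $ i\<rbrakk> \<Longrightarrow> s \<le> r"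
proof -
  define C where "C = (\<lambda>n js. B js + inverse (real (Suc n)))"
  have "\<forall>n. \<exists>x l. x \<in> simplex_vec \<and> (\<forall>i. 0 < x $ i) \<and> 0 \<le> l \<and>
      (\<forall>i. real_apply m (C n) x $ i = l * (x $ i) ^ (m - 1))"
  proof
    fix n
    have "C n js > 0" if "length js = m" for js
      using nonneg that unfolding C_def nonneg_tensor_def by (intro add_nonneg_pos) auto
    then show "\<exists>x l. x \<in> simplex_vec \<and> (\<forall>i. 0 < x $ i) \<and> 0 \<le> l \<and>
        (\<forall>i. real_apply m (C n) x $ i = l * (x $ i) ^ (m - 1))"
      by (rule positive_eigenvector[OF _ m]) blast+
  qed
  then obtain X L where X: "\<And>n. X n \<in> simplex_vec" "\<And>n i. 0 < X n $ i" and L: "\<And>n. 0 \<le> L n"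
    and eig: "\<And>n i. real_apply m (C n) (X n) $ i = L n * (X n $ i) ^ (m - 1)" by metis
  have C_nonneg: "nonneg_tensor m (C n)" for n
    using nonneg by (simp add: C_def nonneg_tensor_def)
  have X_nz: "X n \<noteq> 0" for n using X(2)[of n undefined] by auto
  \<comment> \<open>The perturbation is largest at \<open>n = 0\<close>, so \<open>L 0\<close>
    bounds all the eigenvalues and the pairs \<open>(X n, L n)\<close> stay in a compact
    set.\<close>
  have "L n \<le> L 0" for n
  proof (rule collatz_wielandt_bound[where m = m and B = "C n" and C = "C 0"
        and x = "X 0" and y = "X n"])
    show "C n js \<le> C 0 js" for js by (simp add: C_def inverse_le_1_iff)
  qed (use m C_nonneg X_nz X(2) eig in \<open>auto intro: less_imp_le\<close>)
  then have "\<forall>n. (X n, L n) \<in> simplex_vec \<times> {0..L 0}" using X(1) L by auto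
  moreover have "seq_compact (simplex_vec \<times> {0..L 0} :: ((real ^ 'n) \<times> real) set)"
    by (intro compact_imp_seq_compact compact_Times compact_simplex_vec) simp
  ultimately obtain p h where p: "p \<in> simplex_vec \<times> {0..L 0}" and h: "strict_mono h"
    and lim: "((\<lambda>n. (X n, L n)) \<circ> h) \<longlonglongrightarrow> p"
    by (elim seq_compactE[rotated])
  obtain x r where xr: "p = (x, r)" by fastforce
  have lim_X: "(\<lambda>n. X (h n)) \<longlonglongrightarrow> x" and lim_L: "(\<lambda>n. L (h n)) \<longlonglongrightarrow> r"
    using tendsto_fst[OF lim] tendsto_snd[OF lim] by (simp_all add: xr o_def)
  have lim_C: "(\<lambda>n. C (h n) js) \<longlonglongrightarrow> B js" for js
  proof -
    have "(\<lambda>n. C n js) \<longlonglongrightarrow> B js + 0"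
      unfolding C_def by (intro tendsto_add tendsto_const LIMSEQ_inverse_real_of_nat)
    from LIMSEQ_subseq_LIMSEQ[OF this h] show ?thesis by (simp add: o_def)
  qed
  show ?thesis
  proof (rule that)
    show "x \<in> simplex_vec" "0 \<le> r" using p xr by auto
    show "real_apply m B x $ i = r * (x $ i) ^ (m - 1)" for i
    proof (rule LIMSEQ_unique)
      show "(\<lambda>n. real_apply m (C (h n)) (X (h n)) $ i) \<longlonglongrightarrow> real_apply m B x $ i"
        using m by (intro tendsto_real_apply_nth lim_C lim_X) auto
      show "(\<lambda>n. real_apply m (C (h n)) (X (h n)) $ i) \<longlonglongrightarrow> r * (x $ i) ^ (m - 1)"
        unfolding eig by (intro tendsto_intros lim_L lim_X)
    qed
    fix y :: "real ^ 'n" and s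
    assume y: "\<And>i. 0 \<le> y $ i" "y \<noteq> 0" "\<And>i. s * (y $ i) ^ (m - 1) \<le> real_apply m B y $ i"
    have "s \<le> L n" for n
    proof (rule collatz_wielandt_bound[where m = m and B = B and C = "C n"
          and x = "X n" and y = y])
      show "B js \<le> C n js" for js by (simp add: C_def)
    qed (use m nonneg X(2) eig y in auto)
    then show "s \<le> r" using LIMSEQ_le_const[OF lim_L] by blast
  qed
qed

text \<open>The triangle inequality turns a complex eigenvector into a nonnegative vector of the
  kind to which dominance applies.\<close>

lemma eigenvector_modulus:
  assumes nonneg: "nonneg_tensor m B" and m: "m \<ge> 1" and eig: "tensor_eigenvector m B x l"
  shows "cmod l * ((\<chi> i. cmod (x $ i)) $ i) ^ (m - 1) \<le> real_apply m B (\<chi> i. cmod (x $ i)) $ i"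
proof -
  have "l * (x $ i) ^ (m - 1) = (\<Sum>js | length js = m - 1. of_real (B (i # js)) * (\<Prod>j\<leftarrow>js. x $ j))"
    using eig unfolding tensor_eigenvector_def tensor_apply_def by (simp add: vec_eq_iff)
  then have "cmod l * cmod (x $ i) ^ (m - 1)
      = cmod (\<Sum>js | length js = m - 1. of_real (B (i # js)) * (\<Prod>j\<leftarrow>js. x $ j))"
    by (metis norm_mult norm_power)
  also have "\<dots> \<le> (\<Sum>js | length js = m - 1. cmod (of_real (B (i # js)) * (\<Prod>j\<leftarrow>js. x $ j)))"
    by (rule norm_sum)
  also have "\<dots> = (\<Sum>js | length js = m - 1. B (i # js) * (\<Prod>j\<leftarrow>js. cmod (x $ j)))"
    using nonneg m by (intro sum.cong) (auto simp: norm_mult norm_prod_list_map nonneg_tensor_def)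
  finally show ?thesis by (simp add: real_apply_def)
qed

text \<open>The dominant \<open>r\<close> is itself an eigenvalue and bounds all moduli, so the
  maximum behind \<open>tensor_spectral_radius\<close> is attained and equals
  \<open>r\<close>.\<close>

lemma spectral_radius_nonneg_tensor:
  fixes B :: "'n::finite tensor"
  assumes nonneg: "nonneg_tensor m B" and m: "m \<ge> 2"
  shows "tensor_eigenvalue m B (of_real (tensor_spectral_radius m B))"
    and "tensor_eigenvalue m B l \<Longrightarrow> cmod l \<le> tensor_spectral_radius m B"
proof -
  obtain x r where x: "x \<in> simplex_vec" and r: "0 \<le> r"
    and eig: "\<And>i. real_apply m B x $ i = r * (x $ i) ^ (m - 1)"
    and max: "\<And>y s. \<lbrakk>\<And>i. 0 \<le> y $ i; y \<noteq> 0;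
      \<And>i. s * (y $ i) ^ (m - 1) \<le> real_apply m B y $ i\<rbrakk> \<Longrightarrow> s \<le> r"
    using nonneg_dominant_eigenpair[OF nonneg m] by metis
  have bound: "cmod l \<le> r" if l: "tensor_eigenvalue m B l" for l
  proof -
    obtain y where y: "tensor_eigenvector m B y l"
      using l by (auto simp: tensor_eigenvalue_def)
    then have "y \<noteq> 0" by (simp add: tensor_eigenvector_def)
    then show ?thesis
      using m by (intro max[OF _ _ eigenvector_modulus[OF nonneg _ y]]) (auto simp: vec_eq_iff)
  qed
  define z :: "complex ^ 'n" where "z = (\<chi> i. of_real (x $ i))"
  have ev: "tensor_eigenvalue m B (of_real r)"
    unfolding tensor_eigenvalue_def tensor_eigenvector_def
  proof (intro exI conjI)
    obtain k where "0 < x $ k" using simplex_vecD(3)[OF x] by blast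
    then show "z \<noteq> 0" by (auto simp: z_def vec_eq_iff intro!: exI[of _ k])
    have "tensor_apply m B z $ i = of_real (real_apply m B x $ i)" for i
      by (simp add: tensor_apply_def real_apply_def z_def of_real_prod_list_map)
    then show "tensor_apply m B z = (\<chi> i. of_real r * (z $ i) ^ (m - 1))"
      by (simp add: vec_eq_iff eig z_def)
  qed
  have "tensor_spectral_radius m B = r"
    unfolding tensor_spectral_radius_def
  proof (rule Greatest_equality)
    show "r \<in> {cmod l |l. tensor_eigenvalue m B l}" using ev r by force
  qed (use bound in auto)
  then show "tensor_eigenvalue m B (of_real (tensor_spectral_radius m B))"
    and "tensor_eigenvalue m B l \<Longrightarrow> cmod l \<le> tensor_spectral_radius m B"
    using ev bound by auto
qed

section \<open>Shifts of tensors and the characterisation of M-tensors\<close>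

lemma tensor_eigenvalue_shift:
  fixes A B :: "'n::finite tensor"
  assumes m: "m \<ge> 1" and AB: "\<And>js. length js = m \<Longrightarrow> A js = c * unit_tensor m js - B js"
  shows "tensor_eigenvalue m A l \<longleftrightarrow> tensor_eigenvalue m B (of_real c - l)"
proof -
  have diag: "diagonal_index m (i # js) \<longleftrightarrow> js = replicate (m - 1) i" if "length js = m - 1"
    for i :: 'n and js
    using m by (cases m) (auto simp: diagonal_index_def)
  have "tensor_apply m A x $ i = of_real c * (x $ i) ^ (m - 1) - tensor_apply m B x $ i" for x i
  proof -
    \<comment> \<open>In row \<open>i\<close> the unit tensor contributes only through
      \<open>js = replicate (m - 1) i\<close>, with product \<open>(x $ i) ^ (m - 1)\<close>. Hence
      \<open>A\<close> and \<open>B\<close> share their eigenvectors.\<close>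
    have "tensor_apply m A x $ i = (\<Sum>js | length js = m - 1.
        (if js = replicate (m - 1) i then of_real c * (x $ i) ^ (m - 1) else 0)
        - of_real (B (i # js)) * (\<Prod>j\<leftarrow>js. x $ j))"
      unfolding tensor_apply_def using m
      by (auto simp: AB unit_tensor_def diag algebra_simps intro!: sum.cong)
    also have "\<dots> = of_real c * (x $ i) ^ (m - 1) - tensor_apply m B x $ i"
      by (simp add: sum_subtractf tensor_apply_def finite_lists_of_length)
    finally show ?thesis .
  qed
  then have "tensor_apply m A x $ i = l * (x $ i) ^ (m - 1) \<longleftrightarrow>
      tensor_apply m B x $ i = (of_real c - l) * (x $ i) ^ (m - 1)" for x i
    by (simp only: left_diff_distrib) (auto simp: diff_eq_eq eq_diff_eq add.commute)
  then show ?thesis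
    by (simp add: tensor_eigenvalue_def tensor_eigenvector_def vec_eq_iff)
qed

theorem theorem3p3:
  fixes m :: nat and A :: "'n::finite tensor"
  assumes "m \<ge> 2"
    and "\<And>js. length js = m \<Longrightarrow> \<not> diagonal_index m js \<Longrightarrow> A js \<le> 0"
  shows "M_tensor m A \<longleftrightarrow>
    (\<forall>l::real. tensor_eigenvalue m A (complex_of_real l) \<longrightarrow> l > 0)"
proof
  assume "M_tensor m A"
  then obtain B c where B: "nonneg_tensor m B" "c > tensor_spectral_radius m B"
    and A: "\<And>js. length js = m \<Longrightarrow> A js = c * unit_tensor m js - B js"
    unfolding M_tensor_def by blast
  show "\<forall>l::real. tensor_eigenvalue m A (complex_of_real l) \<longrightarrow> l > 0"
  proof (intro allI impI)
    fix l :: real assume "tensor_eigenvalue m A (of_real l)"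
    then have "tensor_eigenvalue m B (of_real (c - l))"
      using tensor_eigenvalue_shift[OF _ A] assms(1) by simp
    from spectral_radius_nonneg_tensor(2)[OF B(1) assms(1) this]
    have "\<bar>c - l\<bar> \<le> tensor_spectral_radius m B" by (simp only: norm_of_real)
    with B(2) show "l > 0" by linarith
  qed
next
  assume pos: "\<forall>l::real. tensor_eigenvalue m A (complex_of_real l) \<longrightarrow> l > 0"
  \<comment> \<open>The least \<open>c\<close> that makes the diagonal of \<open>B\<close>
    nonnegative; off the diagonal \<open>B js = - A js\<close>, nonnegative by assumption.\<close>
  define c where "c = Max (range (\<lambda>i. A (replicate m i)))"
  define B where "B = (\<lambda>js. c * unit_tensor m js - A js)"
  have A: "A js = c * unit_tensor m js - B js" for js by (simp add: B_def)
  have "A (replicate m i) \<le> c" for i unfolding c_def by (intro Max_ge) auto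
  then have B: "nonneg_tensor m B"
    using assms(2) by (auto simp: nonneg_tensor_def B_def unit_tensor_def diagonal_index_def)
  \<comment> \<open>The spectral radius of \<open>B\<close> is an eigenvalue of \<open>B\<close>, so
    its shift is a real eigenvalue of \<open>A\<close>, and the hypothesis on real eigenvalues
    suffices.\<close>
  have "tensor_eigenvalue m A (of_real (c - tensor_spectral_radius m B))"
    using tensor_eigenvalue_shift[OF _ A] assms(1) spectral_radius_nonneg_tensor(1)[OF B assms(1)]
    by simp
  with pos have "c - tensor_spectral_radius m B > 0" by blast
  then have "c > tensor_spectral_radius m B" by simp
  with A B show "M_tensor m A" unfolding M_tensor_def by blast
qed

end
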